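(* Let $\mathcal O$ be a $\mathcal{RIQ}$-ontology. If a sequent $\Gamma\vdash\Delta$ is provable in $\mathsf S(\mathcal O)$, then $\Gamma\vdash\Delta$ is valid relative to $\mathcal O$.
   Context: Language. Fix countable pairwise disjoint sets $\mathsf{N_C}$ (concept names) and $\mathsf{N_R}$ (role names). A role is $r$ or $r^-$ with $r\in\mathsf{N_R}$; $\mathrm{Inv}(r)=r^-$, $\mathrm{Inv}(r^-)=r$; $\mathbf{R}$ is the set of roles. An RIA is $r_1\circ\cdots\circ r_n\sqsubseteq s$ with $r_i,s\in\mathbf R$; an RBox is a finite set of RIAs. It is regular iff for some strict partial order $\prec$ on $\mathsf{N_R}$ every RIA $w\sqsubseteq r$ in it has $r\in\mathsf{N_R}$ and $w$ equal to $r\circ r$, $r^-$, $s_1\circ\cdots\circ s_n$, $r\circ s_1\circ\cdots\circ s_n$, or $s_1\circ\cdots\circ s_n\circ r$ with all $s_i\prec r$. A role name $r$ is simple w.r.t. RBox $\mathcal R$ iff no RIA $w\sqsubseteq r$ is in $\mathcal R$, or for each $s\sqsubseteq r\in\mathcal R$, $s$ is a simple role name or the inverse of one; $r^-$ is simple iff $r$ is. Concepts: $C::=A\mid\neg A\mid C\sqcup C\mid C\sqcap C\mid\exists r.C\mid\forall r.C\mid{\leqslant}n\,s.C\mid{\geqslant}n\,s.C$ ($A\in\mathsf{N_C}$, $r\in\mathbf R$, $s$ simple, $n\in\mathbb N$). $\top:=A_0\sqcup\neg A_0$, $\bot:=A_0\sqcap\neg A_0$ for fixed $A_0$; literals are $A,\neg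 A$. Negation $\dot\neg$: $\dot\neg A=\neg A$, $\dot\neg\neg A=A$, De Morgan on $\sqcup,\sqcap$, $\exists/\forall$ dual, $\dot\neg({\leqslant}n\,s.C)={\geqslant}(n{+}1)\,s.C$, $\dot\neg({\geqslant}0\,s.C)=\bot$, $\dot\neg({\geqslant}n\,s.C)={\leqslant}(n{-}1)\,s.C$ ($n>0$). A TBox is a finite set of GCIs, each $\top\sqsubseteq C$; a $\mathcal{RIQ}$-ontology is $\mathcal R\cup\mathcal T$, $\mathcal R$ regular RBox, $\mathcal T$ TBox. Semantics standard ($(r^-)^{\mathcal I}$ converse of $r^{\mathcal I}$, counting quantifiers count $s$-successors in $C$); $\mathcal I\models\mathcal O$ iff all RIAs and GCIs hold. $\mathbf R$-system: for each RIA $r_1\circ\cdots\circ r_n\sqsubseteq s\in\mathcal O$ there are productions $s\to r_1\cdots r_n$ and $\mathrm{Inv}(s)\to\mathrm{Inv}(r_n)\cdots\mathrm{Inv}(r_1)$; a rewrite replaces one occurrence of a role $t$ in a string by $T$ for a production $t\to T$; $L_{\mathcal O}(r)$ is the set of strings reachable from the string $r$ by zero or more rewrites. Sequents: $\mathrm{Lab}$ is a countably infinite set of labels. Structural atoms: $r(x,y)$, $x\doteq y$, $x\not\doteq y$; labeled concepts $x:C$. $\Gamma$ forms a tree iff the directed graph on $\mathrm{Lab}(\Gamma)$ with an edge $(x,y)$ per $r(x,y)\in\Gamma$ is a directed tree. A sequent $\Gamma\vdash\Delta$: $\Gamma$ a set of structural atoms forming a tree, $\Delta$ a multiset of labeled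 concepts, $\mathrm{Lab}(\Delta)\subseteq\mathrm{Lab}(\Gamma)$ if $\Gamma\ne\emptyset$, exactly one label in $\Delta$ if $\Gamma=\emptyset$. If the TBox is $\{\top\sqsubseteq C_1,\dots,\top\sqsubseteq C_n\}$, $y:\mathrm{GCI}(\mathcal O)$ denotes $y:\dot\neg C_1,\dots,y:\dot\neg C_n$. $\neq(y_0,\dots,y_n)=\{y_i\not\doteq y_j\mid i<j\}$. $x=^*_\Gamma y$ iff $x,y$ are connected by a (possibly trivial) chain of labels of $\Gamma$ with consecutive ones related by an equality atom of $\Gamma$ in either orientation; $[x]_\Gamma$ its class. Propagation graph of $\Gamma$: vertices $[x]_\Gamma$, edges $([x]_\Gamma,r,[y]_\Gamma)$ and $([y]_\Gamma,\mathrm{Inv}(r),[x]_\Gamma)$ whenever $r(z,w)\in\Gamma$, $z\in[x]_\Gamma$, $w\in[y]_\Gamma$. $[x]_\Gamma\xrightarrow{\varepsilon}[y]_\Gamma$ iff equal; $[x]_\Gamma\xrightarrow{rS}[y]_\Gamma$ iff some edge $([x]_\Gamma,r,[z]_\Gamma)$ with $[z]_\Gamma\xrightarrow{S}[y]_\Gamma$; $[x]_\Gamma\xrightarrow{L}[y]_\Gamma$ iff this holds for some $S\in L$. Calculus $\mathsf S(\mathcal O)$ (premises / conclusion; fresh = not occurring in the conclusion): (id) none / $\Gamma\vdash x:A,x:\neg A,\Delta$. (id$_\doteq$) none / $\Gamma,x\not\doteq y\vdash\Delta$ if $x=^*y$ in the antecedent. ($s_\doteq$) $\Gamma\vdash x:L,y:L,\Delta$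 / $\Gamma\vdash x:L,\Delta$ ($L$ literal, $x=^*_\Gamma y$). ($\sqcup$) $\Gamma\vdash x:C,x:D,\Delta$ / $\Gamma\vdash x:C\sqcup D,\Delta$. ($\sqcap$) $\Gamma\vdash x:C,\Delta$ and $\Gamma\vdash x:D,\Delta$ / $\Gamma\vdash x:C\sqcap D,\Delta$. ($\exists r$) $\Gamma\vdash x:\exists r.C,y:C,\Delta$ / $\Gamma\vdash x:\exists r.C,\Delta$ if $[x]_\Gamma\xrightarrow{L}[y]_\Gamma$, $L=L_{\mathcal O}(r)$. ($\forall r$) $\Gamma,r(x,y)\vdash y:C,y:\mathrm{GCI}(\mathcal O),\Delta$ / $\Gamma\vdash x:\forall r.C,\Delta$, $y$ fresh. (${\leqslant}n\,r$) $\Gamma,\neq(y_0,\dots,y_n),r(x,y_0),\dots,r(x,y_n)\vdash y_0:\dot\neg C,y_0:\mathrm{GCI}(\mathcal O),\dots,y_n:\dot\neg C,y_n:\mathrm{GCI}(\mathcal O),\Delta$ / $\Gamma\vdash x:{\leqslant}n\,r.C,\Delta$, $y_i$ fresh. (${\geqslant}n\,r$) $\Gamma\vdash y_i:C,x:{\geqslant}n\,r.C,\Delta$ ($1\le i\le n$) and $\Gamma,y_i\doteq y_j\vdash x:{\geqslant}n\,r.C,\Delta$ ($1\le i<j\le n$) / $\Gamma\vdash x:{\geqslant}n\,r.C,\Delta$ if $[x]_\Gamma\xrightarrow{L}[y_i]_\Gamma$, $L=L_{\mathcal O}(r)$, for all $i$. A proof is a finite tree of rule instances; provable = has a proof. Sequent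 semantics: for an interpretation $\mathcal I$ and a label assignment $\lambda:\mathrm{Lab}(\Gamma,\Delta)\to\Delta^{\mathcal I}$, $\mathcal I,\lambda\models^\forall\Gamma$ iff $(\lambda(x),\lambda(y))\in r^{\mathcal I}$ for all $r(x,y)\in\Gamma$, $\lambda(x)=\lambda(y)$ for all $x\doteq y\in\Gamma$, $\lambda(x)\ne\lambda(y)$ for all $x\not\doteq y\in\Gamma$; $\mathcal I,\lambda\models^\exists\Delta$ iff $\lambda(x)\in C^{\mathcal I}$ for some $x:C\in\Delta$. $\Gamma\vdash\Delta$ is valid relative to $\mathcal O$ iff for all $\mathcal I$ and $\lambda$: if $\mathcal I\models\mathcal O$ and $\mathcal I,\lambda\models^\forall\Gamma$ then $\mathcal I,\lambda\models^\exists\Delta$. *)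

theory Defs
  imports
    "HOL-Library.Multiset"
    "HOL-Library.Countable"
    "HOL-Library.Infinite_Typeclass"
begin

text \<open>Role names, concept names and labels are the elements of the types 'r, 'c and 'l.\<close>

datatype 'r role = Name 'r | Inverse 'r

fun Inv :: "'r role \<Rightarrow> 'r role" where
  "Inv (Name r) = Inverse r"
| "Inv (Inverse r) = Name r"

fun name_of :: "'r role \<Rightarrow> 'r" where
  "name_of (Name r) = r"
| "name_of (Inverse r) = r"

datatype 'r ria = RIA "'r role list" "'r role"

text \<open>The left-hand side of an RIA is a composition of at least one role.\<close>

definition is_rbox :: "'r ria set \<Rightarrow> bool" where
  "is_rbox R \<longleftrightarrow> finite R \<and> (\<forall>w s. RIA w s \<in> R \<longrightarrow> w \<noteq> [])"

text \<open>A strict order on role names compares roles through their underlying names.\<close>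

definition below :: "('r \<times> 'r) set \<Rightarrow> 'r role list \<Rightarrow> 'r \<Rightarrow> bool" where
  "below prec ss r \<longleftrightarrow> ss \<noteq> [] \<and> (\<forall>s\<in>set ss. (name_of s, r) \<in> prec)"

definition regular :: "'r ria set \<Rightarrow> bool" where
  "regular R \<longleftrightarrow> (\<exists>prec. irrefl prec \<and> trans prec \<and>
     (\<forall>w t. RIA w t \<in> R \<longrightarrow> (\<exists>r. t = Name r \<and>
        (w = [Name r, Name r] \<or>
         w = [Inverse r] \<or>
         below prec w r \<or>
         (\<exists>ss. w = Name r # ss \<and> below prec ss r) \<or>
         (\<exists>ss. w = ss @ [Name r] \<and> below prec ss r)))))"

text \<open>Every left-hand side for a simple role name is a single simple role. The recursion is read
  inductively, so that, for instance, including the inverse of r in r makes r non-simple.\<close>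

inductive simple_name :: "'r ria set \<Rightarrow> 'r \<Rightarrow> bool" for R where
  no_ria: "(\<forall>w. RIA w (Name r) \<notin> R) \<Longrightarrow> simple_name R r"
| all_simple: "(\<forall>w. RIA w (Name r) \<in> R \<longrightarrow> (\<exists>s. w = [s] \<and> simple_name R (name_of s)))
    \<Longrightarrow> simple_name R r"

definition simple :: "'r ria set \<Rightarrow> 'r role \<Rightarrow> bool" where
  "simple R s \<longleftrightarrow> simple_name R (name_of s)"

datatype ('c, 'r) concept =
    Atom 'c
  | NegAtom 'c
  | Or "('c, 'r) concept" "('c, 'r) concept"
  | And "('c, 'r) concept" "('c, 'r) concept"
  | Ex "'r role" "('c, 'r) concept"
  | All "'r role" "('c, 'r) concept"
  | AtMost nat "'r role" "('c, 'r) concept"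
  | AtLeast nat "'r role" "('c, 'r) concept"

primrec wf_concept :: "'r ria set \<Rightarrow> ('c, 'r) concept \<Rightarrow> bool" where
  "wf_concept R (Atom A) \<longleftrightarrow> True"
| "wf_concept R (NegAtom A) \<longleftrightarrow> True"
| "wf_concept R (Or C D) \<longleftrightarrow> wf_concept R C \<and> wf_concept R D"
| "wf_concept R (And C D) \<longleftrightarrow> wf_concept R C \<and> wf_concept R D"
| "wf_concept R (Ex r C) \<longleftrightarrow> wf_concept R C"
| "wf_concept R (All r C) \<longleftrightarrow> wf_concept R C"
| "wf_concept R (AtMost n s C) \<longleftrightarrow> simple R s \<and> wf_concept R C"
| "wf_concept R (AtLeast n s C) \<longleftrightarrow> simple R s \<and> wf_concept R C"

fun is_literal :: "('c, 'r) concept \<Rightarrow> bool" where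
  "is_literal (Atom A) = True"
| "is_literal (NegAtom A) = True"
| "is_literal _ = False"

text \<open>The parameter \<open>A0\<close>, here and below, is the fixed concept name from which top and bottom are
  built.\<close>

definition top_concept :: "'c \<Rightarrow> ('c, 'r) concept" where
  "top_concept A0 = Or (Atom A0) (NegAtom A0)"

definition bot_concept :: "'c \<Rightarrow> ('c, 'r) concept" where
  "bot_concept A0 = And (Atom A0) (NegAtom A0)"

fun neg :: "'c \<Rightarrow> ('c, 'r) concept \<Rightarrow> ('c, 'r) concept" where
  "neg A0 (Atom A) = NegAtom A"
| "neg A0 (NegAtom A) = Atom A"
| "neg A0 (Or C D) = And (neg A0 C) (neg A0 D)"
| "neg A0 (And C D) = Or (neg A0 C) (neg A0 D)"
| "neg A0 (Ex r C) = All r (neg A0 C)"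
| "neg A0 (All r C) = Ex r (neg A0 C)"
| "neg A0 (AtMost n s C) = AtLeast (Suc n) s C"
| "neg A0 (AtLeast 0 s C) = bot_concept A0"
| "neg A0 (AtLeast (Suc n) s C) = AtMost n s C"

text \<open>Every inclusion has top as its left-hand side, so only the right-hand side is stored.\<close>

datatype ('c, 'r) gci = GCI (gci_rhs: "('c, 'r) concept")

record ('c, 'r) ontology =
  rbox :: "'r ria set"
  tbox :: "('c, 'r) gci set"

definition riq_ontology :: "('c, 'r) ontology \<Rightarrow> bool" where
  "riq_ontology ont \<longleftrightarrow> is_rbox (rbox ont) \<and> regular (rbox ont) \<and> finite (tbox ont) \<and>
     (\<forall>g\<in>tbox ont. wf_concept (rbox ont) (gci_rhs g))"

record ('c, 'r, 'd) interp =
  domain :: "'d set"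
  cname_int :: "'c \<Rightarrow> 'd set"
  rname_int :: "'r \<Rightarrow> ('d \<times> 'd) set"

definition is_interp :: "('c, 'r, 'd) interp \<Rightarrow> bool" where
  "is_interp I \<longleftrightarrow> domain I \<noteq> {} \<and> (\<forall>A. cname_int I A \<subseteq> domain I) \<and>
     (\<forall>r. rname_int I r \<subseteq> domain I \<times> domain I)"

fun role_int :: "('c, 'r, 'd) interp \<Rightarrow> 'r role \<Rightarrow> ('d \<times> 'd) set" where
  "role_int I (Name r) = rname_int I r"
| "role_int I (Inverse r) = (rname_int I r)\<inverse>"

primrec roles_int :: "('c, 'r, 'd) interp \<Rightarrow> 'r role list \<Rightarrow> ('d \<times> 'd) set" where
  "roles_int I [] = Id_on (domain I)"
| "roles_int I (r # w) = role_int I r O roles_int I w"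

text \<open>The cardinality of an infinite set is 0 in HOL, hence the finiteness conditions in the
  counting quantifiers.\<close>

primrec concept_int :: "('c, 'r, 'd) interp \<Rightarrow> ('c, 'r) concept \<Rightarrow> 'd set" where
  "concept_int I (Atom A) = cname_int I A"
| "concept_int I (NegAtom A) = domain I - cname_int I A"
| "concept_int I (Or C D) = concept_int I C \<union> concept_int I D"
| "concept_int I (And C D) = concept_int I C \<inter> concept_int I D"
| "concept_int I (Ex r C) =
     {d \<in> domain I. \<exists>e. (d, e) \<in> role_int I r \<and> e \<in> concept_int I C}"
| "concept_int I (All r C) =
     {d \<in> domain I. \<forall>e. (d, e) \<in> role_int I r \<longrightarrow> e \<in> concept_int I C}"
| "concept_int I (AtMost n s C) =
     {d \<in> domain I. finite {e. (d, e) \<in> role_int I s \<and> e \<in> concept_int I C} \<and>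
        card {e. (d, e) \<in> role_int I s \<and> e \<in> concept_int I C} \<le> n}"
| "concept_int I (AtLeast n s C) =
     {d \<in> domain I. infinite {e. (d, e) \<in> role_int I s \<and> e \<in> concept_int I C} \<or>
        n \<le> card {e. (d, e) \<in> role_int I s \<and> e \<in> concept_int I C}}"

definition models :: "'c \<Rightarrow> ('c, 'r, 'd) interp \<Rightarrow> ('c, 'r) ontology \<Rightarrow> bool" where
  "models A0 I ont \<longleftrightarrow>
     (\<forall>w s. RIA w s \<in> rbox ont \<longrightarrow> roles_int I w \<subseteq> role_int I s) \<and>
     (\<forall>C. GCI C \<in> tbox ont \<longrightarrow> concept_int I (top_concept A0) \<subseteq> concept_int I C)"

definition productions :: "('c, 'r) ontology \<Rightarrow> ('r role \<times> 'r role list) set" where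
  "productions ont = {(s, w) | s w. RIA w s \<in> rbox ont} \<union>
     {(Inv s, rev (map Inv w)) | s w. RIA w s \<in> rbox ont}"

definition rewrite :: "('c, 'r) ontology \<Rightarrow> ('r role list \<times> 'r role list) set" where
  "rewrite ont = {(u @ [t] @ v, u @ T @ v) | u t T v. (t, T) \<in> productions ont}"

definition lang :: "('c, 'r) ontology \<Rightarrow> 'r role \<Rightarrow> 'r role list set" where
  "lang ont r = {S. ([r], S) \<in> (rewrite ont)\<^sup>*}"

datatype ('r, 'l) satom = RAtom "'r role" 'l 'l | Eq 'l 'l | Neq 'l 'l

fun atom_labels :: "('r, 'l) satom \<Rightarrow> 'l set" where
  "atom_labels (RAtom r x y) = {x, y}"
| "atom_labels (Eq x y) = {x, y}"
| "atom_labels (Neq x y) = {x, y}"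

type_synonym ('c, 'r, 'l) sequent = "('r, 'l) satom set \<times> ('l \<times> ('c, 'r) concept) multiset"

definition ant_labels :: "('r, 'l) satom set \<Rightarrow> 'l set" where
  "ant_labels \<Gamma> = (\<Union>a\<in>\<Gamma>. atom_labels a)"

definition suc_labels :: "('l \<times> ('c, 'r) concept) multiset \<Rightarrow> 'l set" where
  "suc_labels \<Delta> = fst ` set_mset \<Delta>"

definition seq_labels :: "('c, 'r, 'l) sequent \<Rightarrow> 'l set" where
  "seq_labels S = ant_labels (fst S) \<union> suc_labels (snd S)"

text \<open>A directed tree has a root without predecessor, from which every vertex is reachable, and
  every other vertex has exactly one predecessor.\<close>

definition directed_tree :: "'l set \<Rightarrow> ('l \<times> 'l) set \<Rightarrow> bool" where
  "directed_tree V E \<longleftrightarrow> E \<subseteq> V \<times> V \<and>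
     (\<exists>root\<in>V. (\<forall>u. (u, root) \<notin> E) \<and> (\<forall>v\<in>V - {root}. \<exists>!u. (u, v) \<in> E) \<and>
        (\<forall>v\<in>V. (root, v) \<in> E\<^sup>*))"

definition forms_tree :: "('r, 'l) satom set \<Rightarrow> bool" where
  "forms_tree \<Gamma> \<longleftrightarrow> directed_tree (ant_labels \<Gamma>) {(x, y). \<exists>r. RAtom r x y \<in> \<Gamma>}"

definition is_sequent :: "('c, 'r) ontology \<Rightarrow> ('c, 'r, 'l) sequent \<Rightarrow> bool" where
  "is_sequent ont S \<longleftrightarrow> (case S of (\<Gamma>, \<Delta>) \<Rightarrow>
     (\<forall>(x, C)\<in>set_mset \<Delta>. wf_concept (rbox ont) C) \<and>
     (if \<Gamma> = {} then (\<exists>x. suc_labels \<Delta> = {x})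
      else forms_tree \<Gamma> \<and> suc_labels \<Delta> \<subseteq> ant_labels \<Gamma>))"

definition gci_concepts ::
    "'c \<Rightarrow> ('c, 'r) ontology \<Rightarrow> 'l \<Rightarrow> ('l \<times> ('c, 'r) concept) multiset" where
  "gci_concepts A0 ont y = image_mset (\<lambda>g. (y, neg A0 (gci_rhs g))) (mset_set (tbox ont))"

definition pairwise_neq :: "'l list \<Rightarrow> ('r, 'l) satom set" where
  "pairwise_neq ys = {Neq (ys ! i) (ys ! j) | i j. i < j \<and> j < length ys}"

definition eq_rel :: "('r, 'l) satom set \<Rightarrow> ('l \<times> 'l) set" where
  "eq_rel \<Gamma> = {(x, y). x \<in> ant_labels \<Gamma> \<and> y \<in> ant_labels \<Gamma> \<and>
     (x, y) \<in> {(u, v). Eq u v \<in> \<Gamma> \<or> Eq v u \<in> \<Gamma>}\<^sup>*}"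

definition eq_class :: "('r, 'l) satom set \<Rightarrow> 'l \<Rightarrow> 'l set" where
  "eq_class \<Gamma> x = {y. (x, y) \<in> eq_rel \<Gamma>}"

definition prop_edges :: "('r, 'l) satom set \<Rightarrow> ('l set \<times> 'r role \<times> 'l set) set" where
  "prop_edges \<Gamma> =
     {(eq_class \<Gamma> x, r, eq_class \<Gamma> y) | x r y.
        \<exists>z\<in>eq_class \<Gamma> x. \<exists>w\<in>eq_class \<Gamma> y. RAtom r z w \<in> \<Gamma>} \<union>
     {(eq_class \<Gamma> y, Inv r, eq_class \<Gamma> x) | x r y.
        \<exists>z\<in>eq_class \<Gamma> x. \<exists>w\<in>eq_class \<Gamma> y. RAtom r z w \<in> \<Gamma>}"

primrec prop_path :: "('r, 'l) satom set \<Rightarrow> 'r role list \<Rightarrow> 'l set \<Rightarrow> 'l set \<Rightarrow> bool" where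
  "prop_path \<Gamma> [] X Y \<longleftrightarrow> X = Y"
| "prop_path \<Gamma> (r # S) X Y \<longleftrightarrow> (\<exists>Z. (X, r, Z) \<in> prop_edges \<Gamma> \<and> prop_path \<Gamma> S Z Y)"

definition lang_path ::
    "('r, 'l) satom set \<Rightarrow> 'r role list set \<Rightarrow> 'l \<Rightarrow> 'l \<Rightarrow> bool" where
  "lang_path \<Gamma> L x y \<longleftrightarrow> (\<exists>S\<in>L. prop_path \<Gamma> S (eq_class \<Gamma> x) (eq_class \<Gamma> y))"

text \<open>\<open>rule_inst A0 ont P S\<close>: the premises in \<open>P\<close> yield the conclusion \<open>S\<close>. That all of them are
  sequents is imposed in \<open>provable\<close>. In the rule for \<open>AtMost\<close>
  the fresh labels \<open>ys\<close> have to be distinct; in the rule for \<open>AtLeast\<close> the labels \<open>ys\<close> may repeat.\<close>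

inductive rule_inst ::
    "'c \<Rightarrow> ('c, 'r) ontology \<Rightarrow> ('c, 'r, 'l) sequent set \<Rightarrow> ('c, 'r, 'l) sequent \<Rightarrow> bool"
  for A0 ont where
  id: "rule_inst A0 ont {} (\<Gamma>, {#(x, Atom A), (x, NegAtom A)#} + \<Delta>)"
| id_eq: "(x, y) \<in> eq_rel (insert (Neq x y) \<Gamma>) \<Longrightarrow>
    rule_inst A0 ont {} (insert (Neq x y) \<Gamma>, \<Delta>)"
| s_eq: "is_literal L \<Longrightarrow> (x, y) \<in> eq_rel \<Gamma> \<Longrightarrow>
    rule_inst A0 ont {(\<Gamma>, {#(x, L), (y, L)#} + \<Delta>)} (\<Gamma>, {#(x, L)#} + \<Delta>)"
| or: "rule_inst A0 ont {(\<Gamma>, {#(x, C), (x, D)#} + \<Delta>)} (\<Gamma>, {#(x, Or C D)#} + \<Delta>)"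
| "and": "rule_inst A0 ont {(\<Gamma>, {#(x, C)#} + \<Delta>), (\<Gamma>, {#(x, D)#} + \<Delta>)}
    (\<Gamma>, {#(x, And C D)#} + \<Delta>)"
| ex: "lang_path \<Gamma> (lang ont r) x y \<Longrightarrow>
    rule_inst A0 ont {(\<Gamma>, {#(x, Ex r C), (y, C)#} + \<Delta>)} (\<Gamma>, {#(x, Ex r C)#} + \<Delta>)"
| all: "y \<notin> seq_labels (\<Gamma>, {#(x, All r C)#} + \<Delta>) \<Longrightarrow>
    rule_inst A0 ont
      {(insert (RAtom r x y) \<Gamma>, {#(y, C)#} + gci_concepts A0 ont y + \<Delta>)}
      (\<Gamma>, {#(x, All r C)#} + \<Delta>)"
| at_most: "length ys = Suc n \<Longrightarrow> distinct ys \<Longrightarrow>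
    set ys \<inter> seq_labels (\<Gamma>, {#(x, AtMost n r C)#} + \<Delta>) = {} \<Longrightarrow>
    rule_inst A0 ont
      {(\<Gamma> \<union> pairwise_neq ys \<union> {RAtom r x y | y. y \<in> set ys},
        (\<Sum>y\<leftarrow>ys. {#(y, neg A0 C)#} + gci_concepts A0 ont y) + \<Delta>)}
      (\<Gamma>, {#(x, AtMost n r C)#} + \<Delta>)"
| at_least: "length ys = n \<Longrightarrow> (\<forall>y\<in>set ys. lang_path \<Gamma> (lang ont r) x y) \<Longrightarrow>
    rule_inst A0 ont
      ({(\<Gamma>, {#(ys ! i, C), (x, AtLeast n r C)#} + \<Delta>) | i. i < n} \<union>
       {(insert (Eq (ys ! i) (ys ! j)) \<Gamma>, {#(x, AtLeast n r C)#} + \<Delta>) | i j. i < j \<and> j < n})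
      (\<Gamma>, {#(x, AtLeast n r C)#} + \<Delta>)"

inductive provable :: "'c \<Rightarrow> ('c, 'r) ontology \<Rightarrow> ('c, 'r, 'l) sequent \<Rightarrow> bool"
  for A0 ont where
  "rule_inst A0 ont P S \<Longrightarrow> is_sequent ont S \<Longrightarrow>
   (\<forall>Q\<in>P. is_sequent ont Q \<and> provable A0 ont Q) \<Longrightarrow> provable A0 ont S"

fun atom_sat :: "('c, 'r, 'd) interp \<Rightarrow> ('l \<Rightarrow> 'd) \<Rightarrow> ('r, 'l) satom \<Rightarrow> bool" where
  "atom_sat I lam (RAtom r x y) \<longleftrightarrow> (lam x, lam y) \<in> role_int I r"
| "atom_sat I lam (Eq x y) \<longleftrightarrow> lam x = lam y"
| "atom_sat I lam (Neq x y) \<longleftrightarrow> lam x \<noteq> lam y"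

definition sat_all :: "('c, 'r, 'd) interp \<Rightarrow> ('l \<Rightarrow> 'd) \<Rightarrow> ('r, 'l) satom set \<Rightarrow> bool" where
  "sat_all I lam \<Gamma> \<longleftrightarrow> (\<forall>a\<in>\<Gamma>. atom_sat I lam a)"

definition sat_ex ::
    "('c, 'r, 'd) interp \<Rightarrow> ('l \<Rightarrow> 'd) \<Rightarrow> ('l \<times> ('c, 'r) concept) multiset \<Rightarrow> bool" where
  "sat_ex I lam \<Delta> \<longleftrightarrow> (\<exists>(x, C)\<in>set_mset \<Delta>. lam x \<in> concept_int I C)"

text \<open>HOL cannot quantify over types inside a definition, so the type 'd of which domains of
  interpretations are subsets is a parameter. A theorem concluding validity for an arbitrary 'd
  covers all interpretations.\<close>

definition valid :: "'d itself \<Rightarrow> 'c \<Rightarrow> ('c, 'r) ontology \<Rightarrow> ('c, 'r, 'l) sequent \<Rightarrow> bool" where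
  "valid TYPE('d) A0 ont S \<longleftrightarrow>
     (\<forall>(I :: ('c, 'r, 'd) interp) (lam :: 'l \<Rightarrow> 'd).
        is_interp I \<longrightarrow> lam ` seq_labels S \<subseteq> domain I \<longrightarrow>
        models A0 I ont \<longrightarrow> sat_all I lam (fst S) \<longrightarrow> sat_ex I lam (snd S))"

end

(* Soundness is shown rule by rule. The propagation rules rest on two facts: a satisfying assignment
   is constant on equality classes, so a path in the propagation graph spelling S is mapped to a pair
   in the interpretation of S; and in a model of the RBox rewriting only shrinks the interpretation
   of a string, so S in the language of r makes that pair an r-edge. In the rules with fresh labels,
   the witnesses for the failure of the principal concept are assigned to these labels; the GCI
   concepts of the premise are then false there. *)

theory Submission
  imports Defs
begin

section \<open>Roles and concepts in an interpretation\<close>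

lemma role_int_Inv: "role_int I (Inv r) = (role_int I r)\<inverse>"
  by (cases r) auto

lemma role_int_subset: "is_interp I \<Longrightarrow> role_int I r \<subseteq> domain I \<times> domain I"
  by (cases r) (auto simp: is_interp_def)

text \<open>The empty string denotes the identity on the domain, not on the whole type. It is
  therefore neutral for composition only with relations confined to the domain, which is where the
  lemmas on strings use \<open>is_interp\<close>.\<close>

lemma roles_int_subset: "is_interp I \<Longrightarrow> roles_int I w \<subseteq> domain I \<times> domain I"
proof (induction w)
  case (Cons r w)
  then show ?case using role_int_subset[of I r] by auto
qed auto

lemma roles_int_single: "is_interp I \<Longrightarrow> roles_int I [r] = role_int I r"
  using role_int_subset[of I r] by auto

lemma roles_int_append:
  assumes "is_interp I"
  shows "roles_int I (u @ v) = roles_int I u O roles_int I v"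
proof (induction u)
  case Nil
  then show ?case using roles_int_subset[OF assms, of v] by auto
qed (simp add: O_assoc)

lemma roles_int_rev_Inv:
  assumes "is_interp I"
  shows "roles_int I (rev (map Inv w)) = (roles_int I w)\<inverse>"
proof (induction w)
  case (Cons r w)
  then show ?case
    using roles_int_single[OF assms, of "Inv r"]
    \<comment> \<open>Deleting the cons equation keeps \<open>[Inv r]\<close> folded, so that
      \<open>roles_int_single\<close> applies to it; the second call unfolds the right-hand
      side.\<close>
    by (simp add: roles_int_append[OF assms] role_int_Inv converse_relcomp del: roles_int.simps(2))
      (simp add: converse_relcomp)
qed auto

text \<open>A production of the first kind is an RIA read backwards. One of the second kind follows
  by taking converses on both sides of the inclusion, which reverses the composition.\<close>

lemma production_sound:
  assumes "is_interp I" "models A0 I ont" "(t, T) \<in> productions ont"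
  shows "roles_int I T \<subseteq> role_int I t"
proof -
  have ria: "roles_int I w \<subseteq> role_int I s" if "RIA w s \<in> rbox ont" for w s
    using assms(2) that by (simp add: models_def)
  from assms(3) consider (fwd) "RIA T t \<in> rbox ont"
    | (bwd) s w where "t = Inv s" "T = rev (map Inv w)" "RIA w s \<in> rbox ont"
    by (auto simp: productions_def)
  then show ?thesis
  proof cases
    case fwd
    then show ?thesis by (rule ria)
  next
    case bwd
    then show ?thesis using ria[OF bwd(3)] by (simp add: roles_int_rev_Inv[OF assms(1)] role_int_Inv)
  qed
qed

lemma rewrite_sound:
  assumes "is_interp I" "models A0 I ont" "(u, v) \<in> rewrite ont"
  shows "roles_int I v \<subseteq> roles_int I u"
proof -
  obtain a t T b where u: "u = a @ [t] @ b" and v: "v = a @ T @ b" and p: "(t, T) \<in> productions ont"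
    using assms(3) by (auto simp: rewrite_def)
  have "roles_int I T \<subseteq> roles_int I [t]"
    using production_sound[OF assms(1,2) p] roles_int_single[OF assms(1)] by simp
  then show ?thesis
    unfolding u v roles_int_append[OF assms(1)] by (intro relcomp_mono order_refl)
qed

lemma lang_sound:
  assumes "is_interp I" "models A0 I ont" "S \<in> lang ont r"
  shows "roles_int I S \<subseteq> role_int I r"
proof -
  have "([r], S) \<in> (rewrite ont)\<^sup>*" using assms(3) by (simp add: lang_def)
  then have "roles_int I S \<subseteq> roles_int I [r]"
  proof induction
    case (step v w)
    then show ?case using rewrite_sound[OF assms(1,2) step(2)] by blast
  qed simp
  then show ?thesis using roles_int_single[OF assms(1)] by simp
qed

section \<open>Concepts, negation and GCIs\<close>

lemma concept_int_subset: "is_interp I \<Longrightarrow> concept_int I C \<subseteq> domain I"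
  by (induction C) (auto simp: is_interp_def)

text \<open>Complements are taken within the domain, so in the cases \<open>Ex\<close> and
  \<open>All\<close> the successors must be known to lie there. The split on \<open>n\<close> for
  \<open>AtLeast\<close> follows \<open>neg\<close>: 0 yields bottom, \<open>Suc n\<close> yields
  \<open>AtMost n\<close>.\<close>

lemma concept_int_neg:
  assumes "is_interp I"
  shows "concept_int I (neg A0 C) = domain I - concept_int I C"
proof (induction C)
  case (Ex r C)
  then show ?case using role_int_subset[OF assms, of r] by auto
next
  case (All r C)
  then show ?case using role_int_subset[OF assms, of r] by auto
next
  case (AtLeast n s C)
  then show ?case by (cases n) (auto simp: bot_concept_def)
next
  case (Atom A)
  then show ?case by simp
next
  case (NegAtom A)
  then show ?case using assms by (auto simp: is_interp_def)
qed auto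

lemma concept_int_top: "is_interp I \<Longrightarrow> concept_int I (top_concept A0) = domain I"
  by (auto simp: is_interp_def top_concept_def)

text \<open>Top denotes the whole domain, so in a model every right-hand side of a GCI holds at
  \<open>lam y\<close>, and its negation fails there.\<close>

lemma gci_concept_false:
  assumes "is_interp I" "models A0 I ont" "lam y \<in> domain I" "(z, C) \<in># gci_concepts A0 ont y"
  shows "lam z \<notin> concept_int I C"
proof -
  obtain g where g: "g \<in># mset_set (tbox ont)" and z: "z = y" and C: "C = neg A0 (gci_rhs g)"
    using assms(4) by (auto simp: gci_concepts_def)
  have "g \<in> tbox ont"
    \<comment> \<open>\<open>mset_set\<close> of an infinite set is the empty multiset, so the
      infinite case is vacuous.\<close>
    using g by (cases "finite (tbox ont)") auto
  then have "lam y \<in> concept_int I (gci_rhs g)"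
    using assms(2,3) concept_int_top[OF assms(1), of A0]
    unfolding models_def by (metis gci.collapse subsetD)
  then show ?thesis by (simp add: z C concept_int_neg[OF assms(1)])
qed

lemma gci_concepts_label: "(z, C) \<in># gci_concepts A0 ont y \<Longrightarrow> z = y"
  by (auto simp: gci_concepts_def)

section \<open>Propagation paths\<close>

lemma eq_rel_sound:
  assumes "sat_all I lam \<Gamma>" "(x, y) \<in> eq_rel \<Gamma>"
  shows "lam x = lam y"
proof -
  have "(x, y) \<in> {(u, v). Eq u v \<in> \<Gamma> \<or> Eq v u \<in> \<Gamma>}\<^sup>*"
    using assms(2) by (simp add: eq_rel_def)
  then show ?thesis
  proof induction
    case (step y z)
    then show ?case using assms(1) by (force simp: sat_all_def)
  qed simp
qed

lemma eq_class_sound: "sat_all I lam \<Gamma> \<Longrightarrow> y \<in> eq_class \<Gamma> x \<Longrightarrow> lam y = lam x"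
  using eq_rel_sound by (metis eq_class_def mem_Collect_eq)

lemma eq_class_self: "x \<in> ant_labels \<Gamma> \<Longrightarrow> x \<in> eq_class \<Gamma> x"
  by (simp add: eq_class_def eq_rel_def)

text \<open>\<open>eq_rel\<close> relates labels of \<open>\<Gamma>\<close> only. A class containing
  the endpoint of an edge is thus represented by a label of \<open>\<Gamma>\<close> and cannot be
  the empty class.\<close>

lemma eq_class_nonempty: "z \<in> eq_class \<Gamma> x \<Longrightarrow> x \<in> ant_labels \<Gamma>"
  by (simp add: eq_class_def eq_rel_def)

text \<open>A vertex is a set of labels; extracting a representative of the target that again lies
  in \<open>\<Gamma>\<close> lets the induction along a path continue.\<close>

lemma prop_edge_sound:
  assumes "sat_all I lam \<Gamma>" "x \<in> ant_labels \<Gamma>" "(eq_class \<Gamma> x, r, Z) \<in> prop_edges \<Gamma>"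
  obtains y where "y \<in> ant_labels \<Gamma>" "Z = eq_class \<Gamma> y" "(lam x, lam y) \<in> role_int I r"
proof -
  have atom: "(lam z, lam w) \<in> role_int I s" if "RAtom s z w \<in> \<Gamma>" for s z w
    using assms(1) that by (force simp: sat_all_def)
  \<comment> \<open>An edge may present its source vertex by a representative other than
    \<open>x\<close>; the value under \<open>lam\<close> depends only on the class.\<close>
  have same: "lam a = lam x" if "eq_class \<Gamma> x = eq_class \<Gamma> b" "a \<in> eq_class \<Gamma> b" for a b
    using eq_class_sound[OF assms(1)] that by metis
  from assms(3) consider
    (fwd) x' y z w where "eq_class \<Gamma> x = eq_class \<Gamma> x'" "Z = eq_class \<Gamma> y"
      "z \<in> eq_class \<Gamma> x'" "w \<in> eq_class \<Gamma> y" "RAtom r z w \<in> \<Gamma>"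
  | (bwd) x' y z w s where "eq_class \<Gamma> x = eq_class \<Gamma> x'" "Z = eq_class \<Gamma> y" "r = Inv s"
      "z \<in> eq_class \<Gamma> y" "w \<in> eq_class \<Gamma> x'" "RAtom s z w \<in> \<Gamma>"
    unfolding prop_edges_def by blast
  then show ?thesis
  proof cases
    case fwd
    have "lam z = lam x" "lam w = lam y"
      using same[OF fwd(1,3)] eq_class_sound[OF assms(1) fwd(4)] by simp_all
    then have "(lam x, lam y) \<in> role_int I r" using atom[OF fwd(5)] by simp
    then show ?thesis using that[OF eq_class_nonempty[OF fwd(4)] fwd(2)] by blast
  next
    case bwd
    have "lam w = lam x" "lam z = lam y"
      using same[OF bwd(1,5)] eq_class_sound[OF assms(1) bwd(4)] by simp_all
    then have "(lam x, lam y) \<in> role_int I r" using atom[OF bwd(6)] by (simp add: bwd(3) role_int_Inv)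
    then show ?thesis using that[OF eq_class_nonempty[OF bwd(4)] bwd(2)] by blast
  qed
qed

lemma prop_path_sound:
  assumes "sat_all I lam \<Gamma>" "lam ` ant_labels \<Gamma> \<subseteq> domain I" "y \<in> ant_labels \<Gamma>"
  shows "x \<in> ant_labels \<Gamma> \<Longrightarrow> prop_path \<Gamma> S (eq_class \<Gamma> x) (eq_class \<Gamma> y) \<Longrightarrow>
    (lam x, lam y) \<in> roles_int I S"
proof (induction S arbitrary: x)
  case Nil
  then have "y \<in> eq_class \<Gamma> x" using eq_class_self[OF assms(3)] by simp
  then have "lam y = lam x" by (rule eq_class_sound[OF assms(1)])
  \<comment> \<open>The pair must lie in the identity on the domain, hence the assumption on the
    range of \<open>lam\<close>.\<close>
  then show ?case using assms(2,3) by auto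
next
  case (Cons r S)
  then obtain Z where Z: "(eq_class \<Gamma> x, r, Z) \<in> prop_edges \<Gamma>" "prop_path \<Gamma> S Z (eq_class \<Gamma> y)"
    by auto
  obtain z where "z \<in> ant_labels \<Gamma>" "Z = eq_class \<Gamma> z" "(lam x, lam z) \<in> role_int I r"
    using prop_edge_sound[OF assms(1) Cons.prems(1) Z(1)] .
  then show ?case using Cons.IH[of z] Z(2) by auto
qed

text \<open>With an empty antecedent \<open>x\<close> is the only label; otherwise the antecedent
  already contains all labels. Two sequents sharing \<open>\<Gamma>\<close> and a succedent label
  \<open>x\<close> thus have the same labels, so an assignment admissible for one is admissible for
  the other.\<close>

lemma is_sequent_labels:
  assumes "is_sequent ont (\<Gamma>, \<Delta>)" "x \<in> suc_labels \<Delta>"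
  shows "seq_labels (\<Gamma>, \<Delta>) = insert x (ant_labels \<Gamma>)"
  using assms by (auto simp: is_sequent_def seq_labels_def ant_labels_def split: if_splits)

text \<open>Labels outside \<open>\<Gamma>\<close> all have the empty set as their class and hence look equal in the
  propagation graph. Demanding that both ends label one sequent excludes this.\<close>

lemma lang_path_sound:
  assumes "is_interp I" "models A0 I ont" "sat_all I lam \<Gamma>" "lam ` seq_labels (\<Gamma>, \<Delta>) \<subseteq> domain I"
    and "is_sequent ont (\<Gamma>, \<Delta>)" "x \<in> suc_labels \<Delta>" "y \<in> suc_labels \<Delta>"
    and "lang_path \<Gamma> (lang ont r) x y"
  shows "(lam x, lam y) \<in> role_int I r"
proof -
  obtain S where S: "S \<in> lang ont r" "prop_path \<Gamma> S (eq_class \<Gamma> x) (eq_class \<Gamma> y)"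
    using assms(8) by (auto simp: lang_path_def)
  have "(lam x, lam y) \<in> roles_int I S"
  proof (cases "\<Gamma> = {}")
    case True
    \<comment> \<open>A sequent with empty antecedent has a single label, and its propagation graph
      has no edges, so \<open>S\<close> can only be the empty string.\<close>
    then have "x = y" "prop_edges \<Gamma> = {}"
      using assms(5-7) by (auto simp: is_sequent_def prop_edges_def)
    moreover have "lam x \<in> domain I" using assms(4,6) by (auto simp: seq_labels_def)
    ultimately show ?thesis using S(2) by (cases S) auto
  next
    case False
    then have "x \<in> ant_labels \<Gamma>" "y \<in> ant_labels \<Gamma>"
      using assms(5-7) by (auto simp: is_sequent_def)
    moreover have "lam ` ant_labels \<Gamma> \<subseteq> domain I" using assms(4) by (auto simp: seq_labels_def)
    ultimately show ?thesis using prop_path_sound[OF assms(3)] S(2) by blast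
  qed
  then show ?thesis using lang_sound[OF assms(1,2) S(1)] by blast
qed

section \<open>Soundness of the rules\<close>

lemma suc_labels_union: "suc_labels (\<Delta> + \<Delta>') = suc_labels \<Delta> \<union> suc_labels \<Delta>'"
  by (auto simp: suc_labels_def)

lemma suc_labels_add: "suc_labels (add_mset (x, C) \<Delta>) = insert x (suc_labels \<Delta>)"
  by (auto simp: suc_labels_def)

lemma suc_labels_empty: "suc_labels {#} = {}"
  by (simp add: suc_labels_def)

lemmas suc_labels_simps = suc_labels_union suc_labels_add suc_labels_empty

lemma sat_ex_union: "sat_ex I lam (\<Delta> + \<Delta>') \<longleftrightarrow> sat_ex I lam \<Delta> \<or> sat_ex I lam \<Delta>'"
  by (auto simp: sat_ex_def)

lemma sat_ex_add: "sat_ex I lam (add_mset (x, C) \<Delta>) \<longleftrightarrow> lam x \<in> concept_int I C \<or> sat_ex I lam \<Delta>"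
  by (auto simp: sat_ex_def)

lemma sat_ex_empty: "\<not> sat_ex I lam {#}"
  by (simp add: sat_ex_def)

lemmas sat_ex_simps = sat_ex_union sat_ex_add sat_ex_empty

text \<open>With its analogues for atoms and antecedents, this allows fresh labels to be reassigned
  without affecting the old part of a sequent.\<close>

lemma sat_ex_cong: "(\<And>x. x \<in> suc_labels \<Delta> \<Longrightarrow> lam x = mu x) \<Longrightarrow> sat_ex I lam \<Delta> = sat_ex I mu \<Delta>"
  by (force simp: sat_ex_def suc_labels_def)

lemma atom_sat_cong: "(\<And>x. x \<in> atom_labels a \<Longrightarrow> lam x = mu x) \<Longrightarrow> atom_sat I lam a = atom_sat I mu a"
  by (cases a) auto

lemma sat_all_cong: "(\<And>x. x \<in> ant_labels \<Gamma> \<Longrightarrow> lam x = mu x) \<Longrightarrow> sat_all I lam \<Gamma> = sat_all I mu \<Gamma>"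
  unfolding sat_all_def ant_labels_def by (intro ball_cong atom_sat_cong) auto

text \<open>Validity with the interpretation held fixed. The rules change only the assignment, so
  the induction over proofs can take place inside one model.\<close>

definition holds_in :: "('c, 'r, 'd) interp \<Rightarrow> ('c, 'r, 'l) sequent \<Rightarrow> bool" where
  "holds_in I S \<longleftrightarrow> (\<forall>lam. lam ` seq_labels S \<subseteq> domain I \<longrightarrow> sat_all I lam (fst S) \<longrightarrow>
     sat_ex I lam (snd S))"

lemma holds_inD:
  "holds_in I (\<Gamma>, \<Delta>) \<Longrightarrow> lam ` seq_labels (\<Gamma>, \<Delta>) \<subseteq> domain I \<Longrightarrow> sat_all I lam \<Gamma> \<Longrightarrow> sat_ex I lam \<Delta>"
  by (simp add: holds_in_def)

section \<open>Rules with fresh labels\<close>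

lemma all_sound:
  fixes lam :: "'l \<Rightarrow> 'd"
  assumes I: "is_interp I" and M: "models A0 I ont"
    and fresh: "y \<notin> seq_labels (\<Gamma>, {#(x, All r C)#} + \<Delta>)"
    and prem: "holds_in I (insert (RAtom r x y) \<Gamma>, {#(y, C)#} + gci_concepts A0 ont y + \<Delta>)"
    and dom: "lam ` seq_labels (\<Gamma>, {#(x, All r C)#} + \<Delta>) \<subseteq> domain I"
    and sat: "sat_all I lam \<Gamma>"
  shows "sat_ex I lam ({#(x, All r C)#} + \<Delta>)"
proof (rule ccontr)
  assume neg: "\<not> ?thesis"
  have x: "lam x \<in> domain I" using dom by (simp add: seq_labels_def suc_labels_simps)
  then obtain e where e: "(lam x, e) \<in> role_int I r" "e \<notin> concept_int I C"
    using neg by (auto simp: sat_ex_simps)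
  have ed: "e \<in> domain I" using e(1) role_int_subset[OF I] by blast
  \<comment> \<open>The fresh label receives the successor \<open>e\<close> that refutes the
    universal concept; freshness, which includes \<open>y \<noteq> x\<close>, preserves all other
    values.\<close>
  define mu where "mu = lam(y := e)"
  have agree: "mu z = lam z" if "z \<in> insert x (ant_labels \<Gamma> \<union> suc_labels \<Delta>)" for z
    using that fresh by (auto simp: mu_def seq_labels_def suc_labels_simps)
  have "y \<noteq> x" using fresh by (auto simp: seq_labels_def suc_labels_simps)
  have "sat_all I mu \<Gamma>" using sat sat_all_cong[of \<Gamma> mu lam I] agree by simp
  moreover have "(mu x, mu y) \<in> role_int I r" using e(1) \<open>y \<noteq> x\<close> by (simp add: mu_def)
  ultimately have sat': "sat_all I mu (insert (RAtom r x y) \<Gamma>)" by (simp add: sat_all_def)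
  have "mu ` seq_labels (insert (RAtom r x y) \<Gamma>, {#(y, C)#} + gci_concepts A0 ont y + \<Delta>) \<subseteq> domain I"
  proof -
    have "suc_labels (gci_concepts A0 ont y) \<subseteq> {y}"
      using gci_concepts_label by (force simp: suc_labels_def)
    \<comment> \<open>Removing the principal concept may remove \<open>x\<close> from the succedent,
      but the new role atom brings it back; hence \<open>x\<close> is listed separately.\<close>
    then have "seq_labels (insert (RAtom r x y) \<Gamma>, {#(y, C)#} + gci_concepts A0 ont y + \<Delta>)
      \<subseteq> insert y (insert x (ant_labels \<Gamma> \<union> suc_labels \<Delta>))"
      by (auto simp: seq_labels_def suc_labels_simps ant_labels_def)
    moreover have "mu z \<in> domain I" if "z \<in> insert x (ant_labels \<Gamma> \<union> suc_labels \<Delta>)" for z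
      using that dom by (subst agree) (auto simp: seq_labels_def suc_labels_simps)
    moreover have "mu y \<in> domain I" using ed by (simp add: mu_def)
    ultimately show ?thesis by blast
  qed
  then have "sat_ex I mu ({#(y, C)#} + gci_concepts A0 ont y + \<Delta>)"
    using holds_inD[OF prem] sat' by blast
  moreover have "\<not> sat_ex I mu \<Delta>" using neg sat_ex_cong[of \<Delta> mu lam I] agree by (simp add: sat_ex_simps)
  moreover have "\<not> sat_ex I mu (gci_concepts A0 ont y)"
    using gci_concept_false[OF I M, of mu y] ed by (auto simp: sat_ex_def mu_def)
  ultimately show False using e(2) by (simp add: sat_ex_simps mu_def)
qed

text \<open>An infinite set and a finite one exceeding the bound both contain a subset of exactly
  \<open>Suc n\<close> elements, one for each fresh label. The list form pairs witnesses with labels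
  by position.\<close>

lemma more_than_witnesses:
  assumes "\<not> (finite A \<and> card A \<le> n)"
  obtains es where "length es = Suc n" "distinct es" "set es \<subseteq> A"
proof -
  obtain B where B: "finite B" "card B = Suc n" "B \<subseteq> A"
  proof (cases "finite A")
    case True
    then have "Suc n \<le> card A" using assms by simp
    then show ?thesis using that obtain_subset_with_card_n by metis
  next
    case False
    then show ?thesis using that infinite_arbitrarily_large by metis
  qed
  then show ?thesis using that finite_distinct_list[OF B(1)] by (metis distinct_card)
qed

lemma at_most_sound:
  fixes lam :: "'l \<Rightarrow> 'd"
  assumes I: "is_interp I" and M: "models A0 I ont"
    and ys: "length ys = Suc n" "distinct ys"
    and fresh: "set ys \<inter> seq_labels (\<Gamma>, {#(x, AtMost n r C)#} + \<Delta>) = {}"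
    and prem: "holds_in I (\<Gamma> \<union> pairwise_neq ys \<union> {RAtom r x y | y. y \<in> set ys},
        (\<Sum>y\<leftarrow>ys. {#(y, neg A0 C)#} + gci_concepts A0 ont y) + \<Delta>)"
    and dom: "lam ` seq_labels (\<Gamma>, {#(x, AtMost n r C)#} + \<Delta>) \<subseteq> domain I"
    and sat: "sat_all I lam \<Gamma>"
  shows "sat_ex I lam ({#(x, AtMost n r C)#} + \<Delta>)"
proof (rule ccontr)
  assume neg: "\<not> ?thesis"
  let ?new = "\<Sum>y\<leftarrow>ys. {#(y, neg A0 C)#} + gci_concepts A0 ont y"
  let ?ant = "\<Gamma> \<union> pairwise_neq ys \<union> {RAtom r x y | y. y \<in> set ys}"
  have x: "lam x \<in> domain I" using dom by (simp add: seq_labels_def suc_labels_simps)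
  then have "\<not> (finite {e. (lam x, e) \<in> role_int I r \<and> e \<in> concept_int I C} \<and>
      card {e. (lam x, e) \<in> role_int I r \<and> e \<in> concept_int I C} \<le> n)"
    using neg by (auto simp: sat_ex_simps)
  then obtain es where es: "length es = Suc n" "distinct es"
      "set es \<subseteq> {e. (lam x, e) \<in> role_int I r \<and> e \<in> concept_int I C}"
    using more_than_witnesses by blast
  \<comment> \<open>All fresh labels are reassigned at once: the lookup in the zipped list fails
    exactly at the old labels, which keep their value under \<open>lam\<close>.\<close>
  define mu where "mu z = (case map_of (zip ys es) z of Some e \<Rightarrow> e | None \<Rightarrow> lam z)" for z
  have agree: "mu z = lam z" if "z \<in> insert x (ant_labels \<Gamma> \<union> suc_labels \<Delta>)" for z
  proof -
    have "z \<notin> set ys" using that fresh by (auto simp: seq_labels_def suc_labels_simps)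
    then have "map_of (zip ys es) z = None" using ys es by (simp add: map_of_zip_is_None)
    then show ?thesis by (simp add: mu_def)
  qed
  \<comment> \<open>Distinctness of \<open>ys\<close> makes the lookup return the witness at the
    same position.\<close>
  have nth: "mu (ys ! i) = es ! i" if "i < Suc n" for i
    using map_of_zip_nth[of ys es i] ys es that by (simp add: mu_def)
  have in_es: "mu y \<in> set es" if "y \<in> set ys" for y
    using that ys(1) es(1) nth by (metis in_set_conv_nth)
  have ys_sound: "(mu x, mu y) \<in> role_int I r" "mu y \<in> concept_int I C" "mu y \<in> domain I"
    if "y \<in> set ys" for y
  proof -
    show "(mu x, mu y) \<in> role_int I r" "mu y \<in> concept_int I C"
      using in_es[OF that] es(3) agree[of x] by auto
    then show "mu y \<in> domain I" using role_int_subset[OF I] by blast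
  qed
  have "sat_all I mu \<Gamma>" using sat sat_all_cong[of \<Gamma> mu lam I] agree by simp
  \<comment> \<open>Here distinctness of the witnesses \<open>es\<close> is what satisfies the
    inequality atoms.\<close>
  moreover have "sat_all I mu (pairwise_neq ys)"
    using nth es(1,2) ys(1) by (auto simp: sat_all_def pairwise_neq_def nth_eq_iff_index_eq)
  moreover have "sat_all I mu {RAtom r x y | y. y \<in> set ys}"
    using ys_sound by (auto simp: sat_all_def)
  ultimately have sat': "sat_all I mu ?ant" by (auto simp: sat_all_def)
  have new: "(\<exists>y\<in>set ys. (z, D) = (y, neg A0 C) \<or> (z, D) \<in># gci_concepts A0 ont y)"
    if "(z, D) \<in># ?new" for z D
    using that by (induction ys) auto
  have "mu ` seq_labels (?ant, ?new + \<Delta>) \<subseteq> domain I"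
  proof -
    have "ant_labels ?ant \<subseteq> ant_labels \<Gamma> \<union> insert x (set ys)"
      by (auto simp: ant_labels_def pairwise_neq_def)
    moreover have "suc_labels ?new \<subseteq> set ys"
      using new gci_concepts_label by (force simp: suc_labels_def)
    ultimately have "seq_labels (?ant, ?new + \<Delta>)
      \<subseteq> set ys \<union> insert x (ant_labels \<Gamma> \<union> suc_labels \<Delta>)"
      unfolding seq_labels_def suc_labels_union fst_conv snd_conv by blast
    moreover have "mu z \<in> domain I" if "z \<in> insert x (ant_labels \<Gamma> \<union> suc_labels \<Delta>)" for z
      using that dom by (subst agree) (auto simp: seq_labels_def suc_labels_simps)
    ultimately show ?thesis using ys_sound(3) by blast
  qed
  then have "sat_ex I mu (?new + \<Delta>)" using holds_inD[OF prem] sat' by blast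
  moreover have "\<not> sat_ex I mu \<Delta>" using neg sat_ex_cong[of \<Delta> mu lam I] agree by (simp add: sat_ex_simps)
  moreover have "\<not> sat_ex I mu ?new"
  proof
    assume "sat_ex I mu ?new"
    then obtain z D where zD: "(z, D) \<in># ?new" "mu z \<in> concept_int I D" by (auto simp: sat_ex_def)
    then obtain y where y: "y \<in> set ys"
        "(z, D) = (y, neg A0 C) \<or> (z, D) \<in># gci_concepts A0 ont y"
      using new by blast
    from y(2) show False
    proof
      assume "(z, D) = (y, neg A0 C)"
      then show False using zD(2) ys_sound(2)[OF y(1)] by (simp add: concept_int_neg[OF I])
    next
      assume "(z, D) \<in># gci_concepts A0 ont y"
      then show False using zD(2) gci_concept_false[where lam = mu, OF I M ys_sound(3)[OF y(1)]] by blast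
    qed
  qed
  ultimately show False by (simp add: sat_ex_simps)
qed

text \<open>If the conclusion fails, the premises of the first kind put every \<open>ys ! i\<close>
  into \<open>C\<close>, and the paths make its value an \<open>r\<close>-successor. The equality
  premises keep these values apart, so there are \<open>n\<close> successors after all.\<close>

lemma at_least_sound:
  fixes lam :: "'l \<Rightarrow> 'd"
  assumes I: "is_interp I" and M: "models A0 I ont"
    and ys: "length ys = n" "\<forall>y\<in>set ys. lang_path \<Gamma> (lang ont r) x y"
    and concl: "is_sequent ont (\<Gamma>, {#(x, AtLeast n r C)#} + \<Delta>)"
    and prem: "\<And>i. i < n \<Longrightarrow> is_sequent ont (\<Gamma>, {#(ys ! i, C), (x, AtLeast n r C)#} + \<Delta>) \<and>
        holds_in I (\<Gamma>, {#(ys ! i, C), (x, AtLeast n r C)#} + \<Delta>)"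
    and prem_eq: "\<And>i j. i < j \<Longrightarrow> j < n \<Longrightarrow>
        holds_in I (insert (Eq (ys ! i) (ys ! j)) \<Gamma>, {#(x, AtLeast n r C)#} + \<Delta>)"
    and dom: "lam ` seq_labels (\<Gamma>, {#(x, AtLeast n r C)#} + \<Delta>) \<subseteq> domain I"
    and sat: "sat_all I lam \<Gamma>"
  shows "sat_ex I lam ({#(x, AtLeast n r C)#} + \<Delta>)"
proof (rule ccontr)
  assume neg: "\<not> ?thesis"
  let ?A = "{e. (lam x, e) \<in> role_int I r \<and> e \<in> concept_int I C}"
  have x: "lam x \<in> domain I" using dom by (simp add: seq_labels_def suc_labels_simps)
  \<comment> \<open>That the premise is itself a sequent forces \<open>ys ! i\<close> to be a label
    of the conclusion already, so \<open>lam\<close> is defined on it with a value in the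
    domain.\<close>
  have labels: "seq_labels (\<Gamma>, {#(ys ! i, C), (x, AtLeast n r C)#} + \<Delta>)
      = seq_labels (\<Gamma>, {#(x, AtLeast n r C)#} + \<Delta>)" if "i < n" for i
    using is_sequent_labels[of ont _ _ x] concl prem[OF that] by (simp add: suc_labels_simps)
  have ys_labels: "ys ! i \<in> seq_labels (\<Gamma>, {#(x, AtLeast n r C)#} + \<Delta>)" if "i < n" for i
    unfolding labels[OF that, symmetric] by (simp add: seq_labels_def suc_labels_simps)
  have in_A: "lam (ys ! i) \<in> ?A" if "i < n" for i
  proof -
    have "sat_ex I lam ({#(ys ! i, C), (x, AtLeast n r C)#} + \<Delta>)"
      using holds_inD prem[OF that] labels[OF that] dom sat by metis
    then have "lam (ys ! i) \<in> concept_int I C" using neg by (auto simp: sat_ex_simps)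
    moreover have "(lam x, lam (ys ! i)) \<in> role_int I r"
    proof (rule lang_path_sound[OF I M sat])
      show "lam ` seq_labels (\<Gamma>, {#(ys ! i, C), (x, AtLeast n r C)#} + \<Delta>) \<subseteq> domain I"
        using labels[OF that] dom by simp
    qed (use prem[OF that] ys that in \<open>auto simp: suc_labels_simps\<close>)
    ultimately show ?thesis by simp
  qed
  \<comment> \<open>Equal values would satisfy the antecedent of the equality premise, whose
    succedent is the one assumed to fail.\<close>
  have neq: "lam (ys ! i) \<noteq> lam (ys ! j)" if "i < j" "j < n" for i j
  proof
    assume "lam (ys ! i) = lam (ys ! j)"
    then have "sat_all I lam (insert (Eq (ys ! i) (ys ! j)) \<Gamma>)" using sat by (simp add: sat_all_def)
    moreover have "seq_labels (insert (Eq (ys ! i) (ys ! j)) \<Gamma>, {#(x, AtLeast n r C)#} + \<Delta>)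
        \<subseteq> seq_labels (\<Gamma>, {#(x, AtLeast n r C)#} + \<Delta>)"
      using ys_labels[of i] ys_labels[of j] that by (auto simp: seq_labels_def ant_labels_def)
    ultimately show False using holds_inD[OF prem_eq[OF that]] dom neg by blast
  qed
  have "inj_on (\<lambda>i. lam (ys ! i)) {..<n}"
    using neq by (intro inj_onI) (metis lessThan_iff linorder_neqE_nat)
  then have "card ((\<lambda>i. lam (ys ! i)) ` {..<n}) = n" by (simp add: card_image)
  moreover have "(\<lambda>i. lam (ys ! i)) ` {..<n} \<subseteq> ?A" using in_A by blast
  ultimately have "infinite ?A \<or> n \<le> card ?A" by (metis card_mono)
  then show False using neg x by (simp add: sat_ex_simps)
qed

section \<open>From single rules to whole proofs\<close>

lemma rule_sound:
  assumes I: "is_interp I" and M: "models A0 I ont"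
    and "rule_inst A0 ont P S" "is_sequent ont S"
    and "\<And>Q. Q \<in> P \<Longrightarrow> is_sequent ont Q \<and> holds_in I Q"
  shows "holds_in I S"
  unfolding holds_in_def
proof (intro allI impI)
  fix lam
  assume dom: "lam ` seq_labels S \<subseteq> domain I" and sat: "sat_all I lam (fst S)"
  from assms(3) show "sat_ex I lam (snd S)"
    using assms(4-) dom sat
  proof cases
    case (id \<Gamma> x A \<Delta>)
    then show ?thesis using dom by (auto simp: sat_ex_simps seq_labels_def suc_labels_simps)
  next
    case (id_eq x y \<Gamma> \<Delta>)
    \<comment> \<open>No assignment satisfies this antecedent: the equality chain and the inequality
      atom contradict each other.\<close>
    then show ?thesis using eq_rel_sound[of I lam "fst S" x y] sat by (simp add: sat_all_def)
  next
    case (s_eq L x y \<Gamma> \<Delta>)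
    have "lam x = lam y" using eq_rel_sound[OF _ s_eq(4)] sat s_eq(2) by simp
    \<comment> \<open>Related labels occur in \<open>\<Gamma>\<close>, so the copy at
      \<open>y\<close> introduces no new label.\<close>
    moreover have "seq_labels (\<Gamma>, {#(x, L), (y, L)#} + \<Delta>) = seq_labels S"
      using s_eq(4) by (auto simp: s_eq(2) seq_labels_def suc_labels_simps eq_rel_def)
    then have "sat_ex I lam ({#(x, L), (y, L)#} + \<Delta>)"
      using holds_inD assms(5) dom sat s_eq(1,2) by (metis fst_conv insertI1)
    ultimately show ?thesis by (simp add: s_eq(2) sat_ex_simps)
  next
    case (or \<Gamma> x C D \<Delta>)
    have "sat_ex I lam ({#(x, C), (x, D)#} + \<Delta>)"
      using dom sat assms(5)[unfolded or, OF insertI1]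
      by (intro holds_inD[of I \<Gamma>]) (auto simp: or(2) seq_labels_def suc_labels_simps)
    then show ?thesis by (auto simp: or(2) sat_ex_simps)
  next
    case ("and" \<Gamma> x C \<Delta> D)
    have sub: "sat_ex I lam ({#(x, E)#} + \<Delta>)" if "holds_in I (\<Gamma>, {#(x, E)#} + \<Delta>)" for E
      using dom sat
      by (intro holds_inD[OF that]) (auto simp: "and"(2) seq_labels_def suc_labels_simps)
    have "sat_ex I lam ({#(x, C)#} + \<Delta>)" "sat_ex I lam ({#(x, D)#} + \<Delta>)"
      by (rule sub, rule assms(5)[THEN conjunct2], simp add: "and"(1))+
    then show ?thesis by (auto simp: "and"(2) sat_ex_simps)
  next
    case (ex \<Gamma> r x y C \<Delta>)
    let ?\<Delta> = "{#(x, Ex r C), (y, C)#} + \<Delta>"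
    have prem: "is_sequent ont (\<Gamma>, ?\<Delta>)" "holds_in I (\<Gamma>, ?\<Delta>)"
      using assms(5) ex(1) by auto
    have "seq_labels (\<Gamma>, ?\<Delta>) = seq_labels S"
      using is_sequent_labels[of ont _ _ x] prem(1) assms(4) by (simp add: ex(2) suc_labels_simps)
    then have dom': "lam ` seq_labels (\<Gamma>, ?\<Delta>) \<subseteq> domain I" using dom by simp
    have sat': "sat_all I lam \<Gamma>" using sat ex(2) by simp
    have "(lam x, lam y) \<in> role_int I r"
      by (rule lang_path_sound[OF I M sat' dom' prem(1) _ _ ex(3)]) (simp_all add: suc_labels_simps)
    \<comment> \<open>If the premise is satisfied through \<open>y : C\<close>, then
      \<open>lam y\<close> witnesses the existential concept at \<open>x\<close>; otherwise the same
      concept satisfies the conclusion.\<close>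
    then show ?thesis
      using holds_inD[OF prem(2) dom' sat'] role_int_subset[OF I, of r]
      by (auto simp: ex(2) sat_ex_simps)
  next
    case (all y \<Gamma> x r C \<Delta>)
    then show ?thesis using all_sound[OF I M all(3)] assms(5) dom sat by simp
  next
    case (at_most ys n \<Gamma> x r C \<Delta>)
    then show ?thesis using at_most_sound[OF I M at_most(3-5)] assms(5) dom sat by simp
  next
    case (at_least ys n \<Gamma> r x C \<Delta>)
    have "sat_ex I lam ({#(x, AtLeast n r C)#} + \<Delta>)"
    proof (rule at_least_sound[OF I M at_least(3,4)])
      show "is_sequent ont (\<Gamma>, {#(ys ! i, C), (x, AtLeast n r C)#} + \<Delta>) \<and>
        holds_in I (\<Gamma>, {#(ys ! i, C), (x, AtLeast n r C)#} + \<Delta>)" if "i < n" for i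
        using that by (intro assms(5)) (auto simp: at_least(1))
      show "holds_in I (insert (Eq (ys ! i) (ys ! j)) \<Gamma>, {#(x, AtLeast n r C)#} + \<Delta>)"
        if "i < j" "j < n" for i j
        using that by (intro assms(5)[THEN conjunct2]) (auto simp: at_least(1))
    qed (use assms(4) dom sat at_least(2) in simp_all)
    then show ?thesis by (simp add: at_least(2))
  qed
qed

lemma provable_sound:
  assumes "is_interp I" "models A0 I ont" "provable A0 ont S"
  shows "holds_in I S"
  using assms(3)
proof induction
  case (1 P S)
  then show ?case using rule_sound[OF assms(1,2)] by blast
qed

theorem theorem1:
  fixes A0 :: "'c :: countable"
    and ont :: "('c, 'r :: countable) ontology"
    and \<Gamma> :: "('r, 'l :: {countable, infinite}) satom set"
    and \<Delta> :: "('l \<times> ('c, 'r) concept) multiset"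
  assumes "riq_ontology ont"
    and "is_sequent ont (\<Gamma>, \<Delta>)"
    and "provable A0 ont (\<Gamma>, \<Delta>)"
  shows "valid TYPE('d) A0 ont (\<Gamma>, \<Delta>)"
  using provable_sound[OF _ _ assms(3)] by (auto simp: valid_def holds_in_def)

end
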